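(* Suppose the ideal-sensor (IS) assumption holds: $P(\boldsymbol x=\boldsymbol 1_K|\mathcal H_1)=P(\boldsymbol x=\boldsymbol 0_K|\mathcal H_0)=1$. Then the IGMM-GLRT statistic $\Lambda_{\mathrm{IGMM-GLR}}$ is statistically equivalent to the IS-GLRT statistic $\Lambda_{\mathrm{IS-GLR}}$, and thus attains exact GLRT performance, i.e. it is statistically equivalent to the exact generalized likelihood ratio statistic $\Lambda_{\mathrm{GLR}}$.
   Context: Model. Fix integers $K,N,r\ge1$ with $r<N$. For $i\in\{0,1\}$, under hypothesis $\mathcal H_i$ a random vector $\boldsymbol x\in\{0,1\}^K$ has joint pmf $P(\boldsymbol x|\mathcal H_i)$; put $P_{i,k}=P(x_k=1|\mathcal H_i)$, $\boldsymbol\rho_i=[P_{i,1},\dots,P_{i,K}]^T$ and let $\boldsymbol\Sigma_{\boldsymbol x|\mathcal H_i}$ be the covariance matrix of $\boldsymbol x$ under $\mathcal H_i$. For $k=1,\dots,K$ let $\boldsymbol\mu_k\in\mathbb C^N$ (known line-of-sight vectors) and $\nu_k>0$ (scattered-component powers) be given, let $\sigma_w^2>0$, and set $\widetilde{\boldsymbol A}=[\boldsymbol\mu_1\cdots\boldsymbol\mu_K]$, $\sigma_e^2(\boldsymbol x)=\sigma_w^2+\sum_k\nu_kx_k$, $\sigma_{e,i}^2=\sigma_w^2+\sum_k\nu_kP_{i,k}$. A known full-column-rank matrix $\boldsymbol A_J\in\mathbb C^{N\times r}$ describes the jammer subspace; the jammer contributes an unknown deterministic vector $\boldsymbol\zeta\in\mathbb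 C^r$ and an unknown variance $\sigma_J^2\ge0$ (treated as unrelated free parameters). The pdf of the received vector $\boldsymbol y_s\in\mathbb C^N$ under $\mathcal H_i$ is $$p(\boldsymbol y_s|\mathcal H_i;\boldsymbol\zeta,\sigma_J^2)=\sum_{\boldsymbol x\in\{0,1\}^K}\frac{P(\boldsymbol x|\mathcal H_i)}{\{\pi[\sigma_e^2(\boldsymbol x)+\sigma_J^2]\}^N}\exp\Big(-\frac{\|\boldsymbol y_s-\widetilde{\boldsymbol A}\boldsymbol x-\boldsymbol A_J\boldsymbol\zeta\|^2}{\sigma_e^2(\boldsymbol x)+\sigma_J^2}\Big).$$ Notation. For a vector $\boldsymbol v$, the augmented vector $\underline{\boldsymbol v}$ stacks $\boldsymbol v$ on top of its entrywise conjugate $\boldsymbol v^*$; for a matrix $\boldsymbol A$, $\underline{\boldsymbol A}$ stacks $\boldsymbol A$ on top of $\boldsymbol A^*$. $(\cdot)^\dagger$ is conjugate transpose, $(t)_+=\max\{0,t\}$, $\boldsymbol P^\perp$ is the orthogonal projector of $\mathbb C^N$ onto the orthogonal complement of the range of $\boldsymbol A_J$; $\boldsymbol 1_K,\boldsymbol 0_K$ are the all-ones and all-zeros vectors. All maxima below are over $\boldsymbol\zeta\in\mathbb C^r$, $\sigma_J^2\in[0,\infty)$. Statistics. Exact GLRT: $\Lambda_{\mathrm{GLR}}(\boldsymbol y_s)=\ln\dfrac{\max_{\boldsymbol\zeta,\sigma_J^2}p(\boldsymbol y_s|\mathcal H_1;\boldsymbol\zeta,\sigma_J^2)}{\max_{\boldsymbol\zeta,\sigma_J^2}p(\boldsymbol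 y_s|\mathcal H_0;\boldsymbol\zeta,\sigma_J^2)}$. IS-GLRT: with $\boldsymbol r_0=\boldsymbol P^\perp\boldsymbol y_s$, $\boldsymbol r_1=\boldsymbol P^\perp(\boldsymbol y_s-\widetilde{\boldsymbol A}\boldsymbol 1_K)$, $\hat\sigma_{J,0}^2=(\|\boldsymbol r_0\|^2/N-\sigma_w^2)_+$, $\hat\sigma_{J,1}^2=(\|\boldsymbol r_1\|^2/N-\sigma_e^2(\boldsymbol 1_K))_+$, $$\Lambda_{\mathrm{IS-GLR}}(\boldsymbol y_s)=N\ln\frac{\sigma_w^2+\hat\sigma_{J,0}^2}{\sigma_e^2(\boldsymbol 1_K)+\hat\sigma_{J,1}^2}-\frac{\|\boldsymbol r_1\|^2}{\sigma_e^2(\boldsymbol 1_K)+\hat\sigma_{J,1}^2}+\frac{\|\boldsymbol r_0\|^2}{\sigma_w^2+\hat\sigma_{J,0}^2}.$$ IGMM-GLRT: the law of $\boldsymbol y_s$ under $\mathcal H_i$ is replaced by the improper complex Gaussian law with the same mean, covariance and complementary covariance, i.e. with density $$p_{\mathrm{igmm}}(\boldsymbol y_s|\mathcal H_i;\boldsymbol\zeta,\sigma_J^2)=\frac{1}{\pi^N\det(\boldsymbol R_i)^{1/2}}\exp\Big(-\tfrac12\,\underline{\boldsymbol e_i}^\dagger\boldsymbol R_i^{-1}\underline{\boldsymbol e_i}\Big),\quad \boldsymbol e_i=\boldsymbol y_s-\widetilde{\boldsymbol A}\boldsymbol\rho_i-\boldsymbol A_J\boldsymbol\zeta,$$ $$\boldsymbol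 R_i=\underline{\widetilde{\boldsymbol A}}\,\boldsymbol\Sigma_{\boldsymbol x|\mathcal H_i}\,\underline{\widetilde{\boldsymbol A}}^\dagger+(\sigma_{e,i}^2+\sigma_J^2)\boldsymbol I_{2N},$$ and $\Lambda_{\mathrm{IGMM-GLR}}(\boldsymbol y_s)=\ln\dfrac{\max_{\boldsymbol\zeta,\sigma_J^2}p_{\mathrm{igmm}}(\boldsymbol y_s|\mathcal H_1;\boldsymbol\zeta,\sigma_J^2)}{\max_{\boldsymbol\zeta,\sigma_J^2}p_{\mathrm{igmm}}(\boldsymbol y_s|\mathcal H_0;\boldsymbol\zeta,\sigma_J^2)}$. Statistical equivalence. Two real-valued statistics $\Lambda,\Lambda'$ of $\boldsymbol y_s$ are statistically equivalent if there are constants $c>0$ and $d\in\mathbb R$, not depending on $\boldsymbol y_s$, with $\Lambda(\boldsymbol y_s)=c\,\Lambda'(\boldsymbol y_s)+d$ for all $\boldsymbol y_s\in\mathbb C^N$. *)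

theory Defs
  imports "HOL-Probability.Probability"
begin

text \<open>
  The dimensions \<open>K\<close>, \<open>N\<close>, \<open>r\<close> are the cardinalities of the finite index types
  \<open>'k\<close>, \<open>'n\<close>, \<open>'r\<close>; the augmented space of dimension \<open>2N\<close> is indexed by \<open>'n + 'n\<close>.
\<close>

section \<open>Complex vectors and matrices\<close>

definition cinner :: "complex^'n \<Rightarrow> complex^'n \<Rightarrow> complex" where
  "cinner u v = (\<Sum>i\<in>UNIV. cnj (u $ i) * v $ i)"

definition herm :: "complex^'n^'m \<Rightarrow> complex^'m^'n" where
  "herm A = (\<chi> i j. cnj (A $ j $ i))"

lemma herm_mult: "herm (A ** B) = herm B ** herm A"
  by (simp add: herm_def matrix_matrix_mult_def vec_eq_iff mult.commute)

lemma herm_add: "herm (A + B) = herm A + herm B"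
  by (simp add: herm_def vec_eq_iff)

lemma herm_herm: "herm (herm A) = A"
  by (simp add: herm_def vec_eq_iff)

definition cvec :: "real^'k \<Rightarrow> complex^'k" where
  "cvec x = (\<chi> k. complex_of_real (x $ k))"

definition cmat :: "real^'k^'m \<Rightarrow> complex^'k^'m" where
  "cmat S = (\<chi> j k. complex_of_real (S $ j $ k))"

definition aug_vec :: "complex^'n \<Rightarrow> complex^('n + 'n)" where
  "aug_vec v = (\<chi> i. case i of Inl a \<Rightarrow> v $ a | Inr a \<Rightarrow> cnj (v $ a))"

definition aug_mat :: "complex^'k^'n \<Rightarrow> complex^'k^('n + 'n)" where
  "aug_mat A = (\<chi> i k. case i of Inl a \<Rightarrow> A $ a $ k | Inr a \<Rightarrow> cnj (A $ a $ k))"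

definition ortho_compl :: "(complex^'n) set \<Rightarrow> (complex^'n) set" where
  "ortho_compl S = {v. \<forall>u\<in>S. cinner u v = 0}"

definition ortho_proj :: "(complex^'n) set \<Rightarrow> complex^'n \<Rightarrow> complex^'n" where
  "ortho_proj S y = (THE v. v \<in> S \<and> y - v \<in> ortho_compl S)"

definition proj_perp :: "complex^'r^'n \<Rightarrow> complex^'n \<Rightarrow> complex^'n" where
  "proj_perp AJ = ortho_proj (ortho_compl (range (\<lambda>z. AJ *v z)))"


section \<open>The random vector of sensor decisions\<close>

definition binary_vectors :: "(real^'k) set" where
  "binary_vectors = {x. \<forall>k. x $ k \<in> {0, 1}}"

lemma finite_binary_vectors: "finite (binary_vectors :: (real^'k) set)"
proof -
  have "binary_vectors \<subseteq> vec_lambda ` (UNIV \<rightarrow>\<^sub>E {0, 1 :: real} :: ('k \<Rightarrow> real) set)"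
  proof
    fix x :: "real^'k" assume "x \<in> binary_vectors"
    then have "($) x \<in> UNIV \<rightarrow>\<^sub>E {0, 1}" by (auto simp: binary_vectors_def)
    then show "x \<in> vec_lambda ` (UNIV \<rightarrow>\<^sub>E {0, 1})"
      by (metis image_eqI vec_nth_inverse)
  qed
  then show ?thesis
    by (rule finite_subset) (intro finite_imageI finite_PiE; simp)
qed

definition marginals :: "(real^'k) pmf \<Rightarrow> real^'k" where
  "marginals P = (\<chi> k. measure_pmf.prob P {x. x $ k = 1})"

definition cov_matrix :: "(real^'k) pmf \<Rightarrow> real^'k^'k" where
  "cov_matrix P = (\<chi> j k. measure_pmf.expectation P
     (\<lambda>x. (x $ j - measure_pmf.expectation P (\<lambda>x. x $ j)) *
          (x $ k - measure_pmf.expectation P (\<lambda>x. x $ k))))"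


section \<open>Likelihoods\<close>

definition los_matrix :: "('k \<Rightarrow> complex^'n) \<Rightarrow> complex^'k^'n" where
  "los_matrix mu = (\<chi> i k. mu k $ i)"

text \<open>
  \<open>eff_noise\<close> yields \<open>\<sigma>\<^sub>e\<^sup>2(x)\<close> at a binary vector \<open>x\<close>, and
  \<open>\<sigma>\<^sub>e\<^sub>,\<^sub>i\<^sup>2\<close> at the vector of marginals \<open>\<rho>\<^sub>i\<close>.
\<close>

definition eff_noise :: "('k::finite \<Rightarrow> real) \<Rightarrow> real \<Rightarrow> real^'k \<Rightarrow> real" where
  "eff_noise nu sw2 x = sw2 + (\<Sum>k\<in>UNIV. nu k * x $ k)"

definition mixture_pdf ::
  "('k::finite \<Rightarrow> complex^'n) \<Rightarrow> ('k \<Rightarrow> real) \<Rightarrow> real \<Rightarrow> complex^'r^'n \<Rightarrow> (real^'k) pmf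
     \<Rightarrow> complex^'n \<Rightarrow> complex^'r \<Rightarrow> real \<Rightarrow> real" where
  "mixture_pdf mu nu sw2 AJ P y z sJ2 =
     (\<Sum>x\<in>binary_vectors.
        pmf P x / (pi * (eff_noise nu sw2 x + sJ2)) ^ CARD('n) *
        exp (- ((norm (y - los_matrix mu *v cvec x - AJ *v z))\<^sup>2 / (eff_noise nu sw2 x + sJ2))))"

definition igmm_cov ::
  "('k::finite \<Rightarrow> complex^'n) \<Rightarrow> ('k \<Rightarrow> real) \<Rightarrow> real \<Rightarrow> (real^'k) pmf \<Rightarrow> real
     \<Rightarrow> complex^('n + 'n)^('n + 'n)" where
  "igmm_cov mu nu sw2 P sJ2 =
     aug_mat (los_matrix mu) ** cmat (cov_matrix P) ** herm (aug_mat (los_matrix mu))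
     + mat (complex_of_real (eff_noise nu sw2 (marginals P) + sJ2))"

text \<open>
  The augmented covariance is Hermitian positive definite for \<open>sJ2 \<ge> 0\<close>, \<open>sw2 > 0\<close> and
  \<open>nu k > 0\<close>, so its determinant and the quadratic form of its inverse are real and
  \<open>Re\<close> below only changes the type.
\<close>

definition igmm_pdf ::
  "('k::finite \<Rightarrow> complex^'n) \<Rightarrow> ('k \<Rightarrow> real) \<Rightarrow> real \<Rightarrow> complex^'r^'n \<Rightarrow> (real^'k) pmf
     \<Rightarrow> complex^'n \<Rightarrow> complex^'r \<Rightarrow> real \<Rightarrow> real" where
  "igmm_pdf mu nu sw2 AJ P y z sJ2 =
     (let R = igmm_cov mu nu sw2 P sJ2;
          e = aug_vec (y - los_matrix mu *v cvec (marginals P) - AJ *v z)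
      in 1 / (pi ^ CARD('n) * sqrt (Re (det R))) *
         exp (- (1 / 2) * Re (cinner e (matrix_inv R *v e))))"

lemma herm_igmm_cov: "herm (igmm_cov mu nu sw2 P sJ2) = igmm_cov mu nu sw2 P sJ2"
proof -
  have cov: "herm (cmat (cov_matrix P)) = cmat (cov_matrix P)"
    by (simp add: herm_def cmat_def cov_matrix_def vec_eq_iff mult.commute)
  have scal: "herm (mat (complex_of_real c)) = mat (complex_of_real c)" for c
    by (simp add: herm_def mat_def vec_eq_iff)
  show ?thesis
    unfolding igmm_cov_def herm_add herm_mult herm_herm cov scal by (simp add: matrix_mul_assoc)
qed

lemma det_hermitian_real:
  assumes "herm A = A"
  shows "det A \<in> \<real>"
proof -
  have "cnj (det A) = det (transpose (herm A))"
    by (simp add: det_def herm_def transpose_def)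
  also have "\<dots> = det A" by (simp add: assms det_transpose)
  finally show ?thesis by (simp add: Reals_cnj_iff)
qed


section \<open>Test statistics\<close>

definition max_likelihood ::
  "(complex^'n \<Rightarrow> complex^'r \<Rightarrow> real \<Rightarrow> real) \<Rightarrow> complex^'n \<Rightarrow> real" where
  "max_likelihood p y = (GREATEST m. \<exists>z sJ2. 0 \<le> sJ2 \<and> m = p y z sJ2)"

definition glr_of ::
  "(complex^'n \<Rightarrow> complex^'r \<Rightarrow> real \<Rightarrow> real) \<Rightarrow> (complex^'n \<Rightarrow> complex^'r \<Rightarrow> real \<Rightarrow> real)
     \<Rightarrow> complex^'n \<Rightarrow> real" where
  "glr_of p1 p0 y = ln (max_likelihood p1 y / max_likelihood p0 y)"

definition GLR ::
  "('k::finite \<Rightarrow> complex^'n) \<Rightarrow> ('k \<Rightarrow> real) \<Rightarrow> real \<Rightarrow> complex^'r^'n \<Rightarrow> (real^'k) pmf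
     \<Rightarrow> (real^'k) pmf \<Rightarrow> complex^'n \<Rightarrow> real" where
  "GLR mu nu sw2 AJ P0 P1 = glr_of (mixture_pdf mu nu sw2 AJ P1) (mixture_pdf mu nu sw2 AJ P0)"

definition IGMM_GLR ::
  "('k::finite \<Rightarrow> complex^'n) \<Rightarrow> ('k \<Rightarrow> real) \<Rightarrow> real \<Rightarrow> complex^'r^'n \<Rightarrow> (real^'k) pmf
     \<Rightarrow> (real^'k) pmf \<Rightarrow> complex^'n \<Rightarrow> real" where
  "IGMM_GLR mu nu sw2 AJ P0 P1 = glr_of (igmm_pdf mu nu sw2 AJ P1) (igmm_pdf mu nu sw2 AJ P0)"

definition IS_GLR ::
  "('k::finite \<Rightarrow> complex^'n) \<Rightarrow> ('k \<Rightarrow> real) \<Rightarrow> real \<Rightarrow> complex^'r^'n \<Rightarrow> complex^'n \<Rightarrow> real" where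
  "IS_GLR mu nu sw2 AJ y =
     (let se2 = eff_noise nu sw2 1;
          r0 = proj_perp AJ y;
          r1 = proj_perp AJ (y - los_matrix mu *v 1);
          sJ0 = max 0 ((norm r0)\<^sup>2 / real CARD('n) - sw2);
          sJ1 = max 0 ((norm r1)\<^sup>2 / real CARD('n) - se2)
      in real CARD('n) * ln ((sw2 + sJ0) / (se2 + sJ1))
         - (norm r1)\<^sup>2 / (se2 + sJ1) + (norm r0)\<^sup>2 / (sw2 + sJ0))"

definition statistically_equivalent :: "('y \<Rightarrow> real) \<Rightarrow> ('y \<Rightarrow> real) \<Rightarrow> bool" where
  "statistically_equivalent L L' \<longleftrightarrow> (\<exists>c>0. \<exists>d. \<forall>y. L y = c * L' y + d)"

end

theory Submission
  imports Defs
begin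

text \<open>
  Under the ideal-sensor assumption the sensor vector is almost surely constant, so the mixture has
  a single term and the augmented covariance is a multiple \<open>s\<close> of the identity: both likelihoods
  equal \<open>(\<pi> s)\<^sup>-\<^sup>N exp (- \<parallel>e\<parallel>\<^sup>2 / s)\<close>. Maximising over the jammer
  amplitude projects the residual away from the jammer subspace, and maximising over
  \<open>s \<ge> s\<^sub>0\<close> gives \<open>s = max s\<^sub>0 (\<parallel>r\<parallel>\<^sup>2 / N)\<close>. Hence the three
  statistics coincide.
\<close>

section \<open>Complex orthogonal projection\<close>

lemma Re_cinner: "Re (cinner u v) = inner u v"
  by (simp add: cinner_def inner_vec_def inner_complex_def)

text \<open>Together with \<open>Re_cinner\<close> this upgrades real orthogonality to complex
  orthogonality on any set closed under multiplication by the imaginary unit.\<close>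

lemma Im_cinner: "Im (cinner u v) = inner (\<i> *s u) v"
  by (simp add: cinner_def inner_vec_def inner_complex_def algebra_simps)

lemma cinner_self: "cinner v v = complex_of_real ((norm v)\<^sup>2)"
proof -
  have "Im (cinner v v) = 0"
    by (simp add: cinner_def algebra_simps)
  then show ?thesis
    by (simp add: complex_eq_iff Re_cinner power2_norm_eq_inner)
qed

lemma cinner_diff_right: "cinner u (v - w) = cinner u v - cinner u w"
  by (simp add: cinner_def right_diff_distrib sum_subtractf)

lemma cinner_commute: "cinner u v = cnj (cinner v u)"
  by (simp add: cinner_def mult.commute)

text \<open>Two candidates differ by a vector that lies both in \<open>S\<close> and in its
  complement, so it is orthogonal to itself and vanishes.\<close>

lemma ortho_proj_eqI:
  assumes "v \<in> S" "y - v \<in> ortho_compl S"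
    and closed_diff: "\<And>a b. a \<in> S \<Longrightarrow> b \<in> S \<Longrightarrow> a - b \<in> S"
  shows "ortho_proj S y = v"
  unfolding ortho_proj_def
proof (rule the_equality)
  fix w assume w: "w \<in> S \<and> y - w \<in> ortho_compl S"
  have d: "w - v \<in> S" using w assms by blast
  have "cinner (w - v) (y - v - (y - w)) = 0"
    unfolding cinner_diff_right[of _ "y - v"] using w d assms(2) by (simp add: ortho_compl_def)
  then have "cinner (w - v) (w - v) = 0" by simp
  then show "w = v" by (simp add: cinner_self)
qed (use assms in blast)

lemma subspace_range_matrix: "subspace (range (\<lambda>z. A *v z))" for A :: "complex^'r^'n"
proof -
  have "linear (\<lambda>z. A *v z)"
    by (rule linearI)
      (auto simp: matrix_vector_mult_def vec_eq_iff sum.distrib scaleR_sum_right algebra_simps)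
  then show ?thesis by (rule linear_subspace_image) (rule subspace_UNIV)
qed

lemma proj_perp_residual:
  fixes A :: "complex^'r^'n"
  obtains z where "proj_perp A y = y - A *v z"
    and "proj_perp A y \<in> ortho_compl (range (\<lambda>z. A *v z))"
proof -
  let ?S = "range (\<lambda>z. A *v z)"
  obtain u v where u: "u \<in> span ?S" and v: "\<And>w. w \<in> span ?S \<Longrightarrow> orthogonal v w" and y: "y = u + v"
    using orthogonal_subspace_decomp_exists by metis
  have span: "span ?S = ?S"
    using subspace_range_matrix by (simp add: span_eq_iff)
  obtain z where z: "u = A *v z" using u span by auto
  \<comment> \<open>So far \<open>v\<close> is orthogonal to the range only for the real inner
    product. The range is closed under multiplication by the imaginary unit, so the imaginary part
    vanishes too.\<close>
  have "cinner (A *v w) v = 0" for w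
  proof -
    have "\<i> *s (A *v w) = A *v (\<i> *s w)"
      by (simp add: vector_scalar_commute)
    then have "\<i> *s (A *v w) \<in> ?S" by simp
    then have "inner (\<i> *s (A *v w)) v = 0" "inner (A *v w) v = 0"
      using v unfolding span orthogonal_def by (metis inner_commute rangeI)+
    then show ?thesis by (simp add: complex_eq_iff Re_cinner Im_cinner)
  qed
  then have perp: "v \<in> ortho_compl ?S" by (auto simp: ortho_compl_def)
  \<comment> \<open>\<open>proj_perp\<close> projects onto the complement of the range, so the
    remainder \<open>u\<close> has to lie in the double complement; conjugate symmetry gives this
    inclusion.\<close>
  have "u \<in> ortho_compl (ortho_compl ?S)"
    unfolding ortho_compl_def z by (auto intro: cinner_commute[THEN trans])
  then have "proj_perp A y = v"
    unfolding proj_perp_def using perp y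
    by (intro ortho_proj_eqI) (auto simp: ortho_compl_def cinner_diff_right)
  then show ?thesis using perp y z by (intro that[of z]) auto
qed

text \<open>Pythagoras: \<open>y - A *v z\<close> is the residual plus a vector of the range, and
  the two are orthogonal.\<close>

lemma norm_proj_perp_le:
  fixes A :: "complex^'r^'n"
  shows "norm (proj_perp A y) \<le> norm (y - A *v z)"
proof -
  obtain z0 where z0: "proj_perp A y = y - A *v z0"
    and perp: "proj_perp A y \<in> ortho_compl (range (\<lambda>z. A *v z))"
    by (rule proj_perp_residual)
  let ?d = "A *v (z0 - z)"
  have "cinner ?d (proj_perp A y) = 0"
    using perp by (simp add: ortho_compl_def)
  then have "inner (proj_perp A y) ?d = 0"
    using Re_cinner[of ?d "proj_perp A y"] by (simp only: inner_commute zero_complex.sel(1))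
  then have "(norm (proj_perp A y + ?d))\<^sup>2 = (norm (proj_perp A y))\<^sup>2 + (norm ?d)\<^sup>2"
    by (simp add: norm_add_Pythagorean orthogonal_def)
  moreover have "proj_perp A y + ?d = y - A *v z"
    by (simp add: z0 matrix_vector_mult_diff_distrib)
  ultimately have "(norm (proj_perp A y))\<^sup>2 \<le> (norm (y - A *v z))\<^sup>2" by simp
  then show ?thesis by (simp add: power2_le_iff_abs_le)
qed


section \<open>Isotropic Gaussian likelihood\<close>

text \<open>Density of a circular complex Gaussian with covariance \<open>s\<close> times the
  identity in dimension \<open>n\<close>, at squared distance \<open>a\<close> from its mean. The
  jammer amplitude enters only through \<open>a\<close>, the jammer variance only through
  \<open>s\<close>.\<close>

definition gauss_lik :: "nat \<Rightarrow> real \<Rightarrow> real \<Rightarrow> real" where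
  "gauss_lik n a s = 1 / (pi * s) ^ n * exp (- (a / s))"

lemma gauss_lik_pos: "s > 0 \<Longrightarrow> gauss_lik n a s > 0"
  by (simp add: gauss_lik_def)

lemma gauss_lik_nonzero: "s > 0 \<Longrightarrow> gauss_lik n a s \<noteq> 0"
  using gauss_lik_pos by (metis less_irrefl)

lemma ln_gauss_lik:
  assumes "s > 0"
  shows "ln (gauss_lik n a s) = - real n * ln pi - real n * ln s - a / s"
  using assms by (simp add: gauss_lik_def ln_mult ln_div ln_realpow algebra_simps)

lemma gauss_lik_antimono:
  assumes "a \<le> b" "s > 0"
  shows "gauss_lik n b s \<le> gauss_lik n a s"
  using assms by (auto simp: gauss_lik_def divide_right_mono intro!: mult_left_mono)

text \<open>Instead of differentiating, the bound ln u \<le> u - 1 at u = t / s shows that the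
  log-likelihood gain from \<open>s\<close> to \<open>t\<close> is at least (s - t) (n - a / t) /
  s.\<close>

lemma gauss_lik_le_max:
  fixes a s0 s :: real
  assumes "n > 0" "s0 > 0" "s0 \<le> s"
  defines "t \<equiv> max s0 (a / real n)"
  shows "gauss_lik n a s \<le> gauss_lik n a t"
proof -
  have t: "t > 0" and s: "s > 0" using assms by auto
  \<comment> \<open>Either the constraint binds, and both factors are nonnegative, or
    \<open>t\<close> is the unconstrained maximiser and the second factor is zero.\<close>
  have sign: "(s - t) * (real n - a / t) \<ge> 0"
  proof (cases "a / real n \<le> s0")
    case True
    then have "t = s0" "a / t \<le> real n" using assms by (auto simp: field_simps)
    then show ?thesis using assms by simp
  next
    case False
    then have "t = a / real n" by (simp add: t_def)
    then have "a / t = real n" using t assms by auto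
    then show ?thesis by simp
  qed
  have "1 - t / s \<le> ln s - ln t"
    using ln_le_minus_one[of "t / s"] s t by (simp add: ln_div)
  then have "real n * (1 - t / s) \<le> real n * (ln s - ln t)"
    by (intro mult_left_mono) auto
  moreover have "real n * (1 - t / s) + a / s - a / t = (s - t) * (real n - a / t) / s"
    using s t by (simp add: field_simps)
  moreover have "(s - t) * (real n - a / t) / s \<ge> 0" using sign s by simp
  ultimately have "ln (gauss_lik n a s) \<le> ln (gauss_lik n a t)"
    using s t by (simp add: ln_gauss_lik algebra_simps)
  then show ?thesis using s t by (simp add: gauss_lik_pos)
qed

text \<open>The two maximisations decouple: the likelihood decreases in the squared residual for
  every variance, so the projection residual is optimal whatever \<open>sJ2\<close> is. Attainment
  is shown first, as \<open>GREATEST\<close> requires a value in the set.\<close>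

lemma max_likelihood_gauss:
  fixes p :: "complex^'n \<Rightarrow> complex^'r \<Rightarrow> real \<Rightarrow> real"
  assumes "s0 > 0"
    and p: "\<And>z sJ2. 0 \<le> sJ2 \<Longrightarrow>
      p y z sJ2 = gauss_lik CARD('n) ((norm (w - AJ *v z))\<^sup>2) (s0 + sJ2)"
  defines "a \<equiv> (norm (proj_perp AJ w))\<^sup>2"
  shows "max_likelihood p y
    = gauss_lik CARD('n) a (s0 + max 0 (a / real CARD('n) - s0))"
  unfolding max_likelihood_def
proof (rule Greatest_equality)
  obtain z where "proj_perp AJ w = w - AJ *v z" by (rule proj_perp_residual)
  then show "\<exists>z sJ2. 0 \<le> sJ2 \<and>
      gauss_lik CARD('n) a (s0 + max 0 (a / real CARD('n) - s0)) = p y z sJ2"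
    unfolding a_def by (intro exI[of _ z] exI[of _ "max 0 (a / real CARD('n) - s0)"]) (simp add: p a_def)
next
  fix m assume "\<exists>z sJ2. 0 \<le> sJ2 \<and> m = p y z sJ2"
  then obtain z sJ2 where sJ2: "0 \<le> sJ2" and m: "m = p y z sJ2" by blast
  have "m \<le> gauss_lik CARD('n) a (s0 + sJ2)"
    unfolding m p[OF sJ2] a_def using sJ2 assms(1)
    by (intro gauss_lik_antimono power_mono norm_proj_perp_le) auto
  also have "\<dots> \<le> gauss_lik CARD('n) a (max s0 (a / real CARD('n)))"
    using sJ2 assms(1) by (intro gauss_lik_le_max) auto
  \<comment> \<open>Additive form, with the clipped jammer variance estimate of
    \<open>IS_GLR\<close> made explicit.\<close>
  also have "max s0 (a / real CARD('n)) = s0 + max 0 (a / real CARD('n) - s0)"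
    by (simp add: max_def)
  finally show "m \<le> gauss_lik CARD('n) a (s0 + max 0 (a / real CARD('n) - s0))" .
qed


section \<open>Deterministic sensor vector\<close>

lemma pmf_eq_return_pmf:
  assumes "measure_pmf.prob P {x. x = a} = 1"
  shows "P = return_pmf a"
proof -
  have "AE x in measure_pmf P. x \<in> {x. x = a}"
    using assms by (simp add: measure_pmf.prob_eq_1)
  then have "set_pmf P \<subseteq> {a}" by (auto simp: AE_measure_pmf_iff)
  then show ?thesis by (simp add: set_pmf_subset_singleton)
qed

text \<open>Entries in {0, 1} are needed: only then is the indicator of \<open>x $ k = 1\<close>
  equal to \<open>x $ k\<close>.\<close>

lemma marginals_return_pmf:
  assumes "x \<in> binary_vectors"
  shows "marginals (return_pmf x) = x"
  using assms by (auto simp: marginals_def binary_vectors_def vec_eq_iff indicator_def)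

lemma cov_matrix_return_pmf: "cov_matrix (return_pmf x) = 0"
  by (simp add: cov_matrix_def vec_eq_iff)

lemma mixture_pdf_return_pmf:
  fixes AJ :: "complex^'r^'n" and mu :: "'k::finite \<Rightarrow> complex^'n"
  assumes "x \<in> binary_vectors"
  shows "mixture_pdf mu nu sw2 AJ (return_pmf x) y z sJ2
    = gauss_lik CARD('n) ((norm (y - los_matrix mu *v cvec x - AJ *v z))\<^sup>2) (eff_noise nu sw2 x + sJ2)"
proof -
  have "mixture_pdf mu nu sw2 AJ (return_pmf x) y z sJ2 = (\<Sum>x'\<in>binary_vectors. if x' = x then
      gauss_lik CARD('n) ((norm (y - los_matrix mu *v cvec x - AJ *v z))\<^sup>2) (eff_noise nu sw2 x + sJ2) else 0)"
    unfolding mixture_pdf_def by (intro sum.cong) (auto simp: gauss_lik_def indicator_def)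
  then show ?thesis using assms by (simp add: finite_binary_vectors)
qed

lemma det_mat: "det (mat c :: 'a::comm_ring_1^'n^'n) = c ^ CARD('n)"
  by (subst det_diagonal) (simp_all add: mat_def)

lemma matrix_inv_eqI:
  fixes A B :: "'a::semiring_1^'n^'n"
  assumes "A ** B = mat 1" "B ** A = mat 1"
  shows "matrix_inv A = B"
  unfolding matrix_inv_def
proof (rule some_equality)
  fix C assume "A ** C = mat 1 \<and> C ** A = mat 1"
  then show "C = B" using assms by (metis matrix_mul_assoc matrix_mul_lid matrix_mul_rid)
qed (use assms in blast)

lemma matrix_inv_mat:
  assumes "c \<noteq> (0::'a::field)"
  shows "matrix_inv (mat c :: 'a^'n^'n) = mat (inverse c)"
  by (rule matrix_inv_eqI)
    (use assms in \<open>auto simp: matrix_matrix_mult_def mat_def vec_eq_iff mult_delta_left\<close>)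

lemma cinner_mat: "cinner u (mat c *v v) = c * cinner u v"
proof -
  have "(mat c *v v) $ i = c * v $ i" for i
    by (simp add: matrix_vector_mult_def mat_def if_distrib if_distribR cong: if_cong)
  then show ?thesis by (simp add: cinner_def sum_distrib_left mult.left_commute)
qed

text \<open>This factor 2 cancels the 1/2 in the exponent of \<open>igmm_pdf\<close>.\<close>

lemma norm_aug_vec: "(norm (aug_vec e))\<^sup>2 = 2 * (norm e)\<^sup>2"
proof -
  have "(norm (aug_vec e))\<^sup>2 = (\<Sum>i\<in>UNIV <+> UNIV. (norm (aug_vec e $ i))\<^sup>2)"
    by (simp add: norm_vec_def L2_set_def sum_nonneg)
  also have "\<dots> = 2 * (norm e)\<^sup>2"
    by (subst sum.Plus) (auto simp: aug_vec_def norm_vec_def L2_set_def sum_nonneg)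
  finally show ?thesis .
qed

lemma igmm_pdf_return_pmf:
  fixes AJ :: "complex^'r^'n" and mu :: "'k::finite \<Rightarrow> complex^'n"
  assumes "x \<in> binary_vectors" "eff_noise nu sw2 x + sJ2 > 0"
  shows "igmm_pdf mu nu sw2 AJ (return_pmf x) y z sJ2
    = gauss_lik CARD('n) ((norm (y - los_matrix mu *v cvec x - AJ *v z))\<^sup>2) (eff_noise nu sw2 x + sJ2)"
proof -
  define s where "s = eff_noise nu sw2 x + sJ2"
  define e where "e = y - los_matrix mu *v cvec x - AJ *v z"
  have s: "s > 0" using assms by (simp add: s_def)
  have "cmat (0::real^'k^'k) = 0" by (simp add: cmat_def vec_eq_iff)
  then have R: "igmm_cov mu nu sw2 (return_pmf x) sJ2 = mat (complex_of_real s)"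
    by (simp add: igmm_cov_def cov_matrix_return_pmf marginals_return_pmf[OF assms(1)] s_def)
  \<comment> \<open>The augmented dimension is 2N, so the square root in the density leaves the
    power N of the circular case.\<close>
  have "Re (det (mat (complex_of_real s) :: complex^('n + 'n)^('n + 'n))) = (s ^ CARD('n))\<^sup>2"
    by (simp add: det_mat power_mult[symmetric] mult_2_right power_add power2_eq_square flip: of_real_power of_real_mult)
  then have det: "sqrt (Re (det (mat (complex_of_real s) :: complex^('n + 'n)^('n + 'n)))) = s ^ CARD('n)"
    using s by simp
  have "Re (cinner (aug_vec e) (matrix_inv (mat (complex_of_real s)) *v aug_vec e)) = 2 * ((norm e)\<^sup>2 / s)"
    using s by (simp add: matrix_inv_mat cinner_mat cinner_self norm_aug_vec divide_inverse mult.commute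
        flip: of_real_inverse of_real_mult)
  then show ?thesis
    unfolding igmm_pdf_def Let_def R marginals_return_pmf[OF assms(1)] det e_def[symmetric]
      s_def[symmetric] gauss_lik_def by (simp add: power_mult_distrib)
qed


theorem lemma4:
  fixes mu :: "'k::finite \<Rightarrow> complex^'n::finite"
    and nu :: "'k \<Rightarrow> real"
    and sw2 :: real
    and AJ :: "complex^'r::finite^'n"
    and P0 P1 :: "(real^'k) pmf"
  assumes "CARD('r) < CARD('n)"
    and "rank AJ = CARD('r)"
    and "sw2 > 0"
    and "\<And>k. nu k > 0"
    and "set_pmf P0 \<subseteq> binary_vectors"
    and "set_pmf P1 \<subseteq> binary_vectors"
    and IS1: "measure_pmf.prob P1 {x. x = 1} = 1"
    and IS0: "measure_pmf.prob P0 {x. x = 0} = 1"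
  shows "statistically_equivalent (IGMM_GLR mu nu sw2 AJ P0 P1) (IS_GLR mu nu sw2 AJ)
       \<and> statistically_equivalent (IGMM_GLR mu nu sw2 AJ P0 P1) (GLR mu nu sw2 AJ P0 P1)"
proof -
  have P: "P1 = return_pmf 1" "P0 = return_pmf 0"
    using IS1 IS0 by (auto intro: pmf_eq_return_pmf)
  have bin: "1 \<in> (binary_vectors :: (real^'k) set)" "0 \<in> (binary_vectors :: (real^'k) set)"
    by (auto simp: binary_vectors_def)
  have cvec: "cvec (1 :: real^'k) = 1" "cvec (0 :: real^'k) = 0"
    by (auto simp: cvec_def vec_eq_iff)
  define se2 where "se2 = eff_noise nu sw2 1"
  have sw2: "eff_noise nu sw2 0 = sw2" by (simp add: eff_noise_def)
  have se2: "se2 > 0"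
    using assms(3,4) by (simp add: se2_def eff_noise_def add_pos_nonneg less_imp_le sum_nonneg)
  let ?n = "CARD('n)"
  define s where "s s0 a = s0 + max 0 (a / real ?n - s0)" for s0 a :: real
  define a0 a1 where "a0 y = (norm (proj_perp AJ y))\<^sup>2"
    and "a1 y = (norm (proj_perp AJ (y - los_matrix mu *v 1)))\<^sup>2" for y
  have s_pos: "s s0 a > 0" if "s0 > 0" for s0 a using that by (simp add: s_def)
  \<comment> \<open>The mean without jammer is zero here, so the projected vector is
    \<open>y\<close> itself; under \<open>P1\<close> it is shifted by
    \<open>los_matrix mu *v 1\<close>, and the variance floor rises from \<open>sw2\<close> to
    \<open>se2\<close>.\<close>
  have M0: "max_likelihood (mixture_pdf mu nu sw2 AJ P0) y = gauss_lik ?n (a0 y) (s sw2 (a0 y))"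
    and I0: "max_likelihood (igmm_pdf mu nu sw2 AJ P0) y = gauss_lik ?n (a0 y) (s sw2 (a0 y))" for y
    unfolding s_def a0_def P using assms(3) bin
    by (auto intro!: max_likelihood_gauss simp: mixture_pdf_return_pmf igmm_pdf_return_pmf sw2 cvec)
  have M1: "max_likelihood (mixture_pdf mu nu sw2 AJ P1) y = gauss_lik ?n (a1 y) (s se2 (a1 y))"
    and I1: "max_likelihood (igmm_pdf mu nu sw2 AJ P1) y = gauss_lik ?n (a1 y) (s se2 (a1 y))" for y
    unfolding s_def a1_def P using se2 bin
    by (auto intro!: max_likelihood_gauss
        simp: mixture_pdf_return_pmf igmm_pdf_return_pmf se2_def[symmetric] cvec)
  have eq: "IGMM_GLR mu nu sw2 AJ P0 P1 = GLR mu nu sw2 AJ P0 P1"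
    by (simp add: fun_eq_iff IGMM_GLR_def GLR_def glr_of_def M0 M1 I0 I1)
  have "IGMM_GLR mu nu sw2 AJ P0 P1 y = IS_GLR mu nu sw2 AJ y" for y
  proof -
    have p: "s sw2 (a0 y) > 0" "s se2 (a1 y) > 0" using assms(3) se2 by (simp_all add: s_pos)
    have "IGMM_GLR mu nu sw2 AJ P0 P1 y
      = ln (gauss_lik ?n (a1 y) (s se2 (a1 y))) - ln (gauss_lik ?n (a0 y) (s sw2 (a0 y)))"
      unfolding IGMM_GLR_def glr_of_def I0 I1 using p by (simp add: ln_div gauss_lik_nonzero)
    \<comment> \<open>The terms in ln pi agree under both hypotheses and cancel.\<close>
    also have "\<dots> = real ?n * ln (s sw2 (a0 y) / s se2 (a1 y))
        - a1 y / s se2 (a1 y) + a0 y / s sw2 (a0 y)"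
      using p by (simp add: ln_gauss_lik ln_div algebra_simps)
    also have "\<dots> = IS_GLR mu nu sw2 AJ y"
      by (simp add: IS_GLR_def Let_def s_def a0_def a1_def se2_def)
    finally show ?thesis .
  qed
  then show ?thesis
    unfolding statistically_equivalent_def eq
    by (intro conjI exI[of _ "1::real"] exI[of _ "0::real"]) simp_all
qed

end
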